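(* Let $G=(N,S,C)$ be a finite normal form game with $n\ge 2$ players and let $w_i:S_{-i}\to(0,\infty)$, $i=1,\dots,n$, be given coset-depending weights. Then $G$ is a coset weighted potential game with weights $w_i(s_{-i})$ if and only if the linear system $$\Psi_w\,\xi^w=b^w$$ in the unknown column vector $\xi^w=(\xi^w_1;\xi^w_2;\dots;\xi^w_n)$ (blocks stacked vertically, $\xi^w_i\in\mathbb{R}^{k/k_i}$) has a solution, where $$\Psi_w=\begin{bmatrix}-\Lambda_2E_1&\Lambda_1E_2&0&\cdots&0\\-\Lambda_3E_1&0&\Lambda_1E_3&\cdots&0\\ \vdots&\vdots&\vdots&\ddots&\vdots\\-\Lambda_nE_1&0&0&\cdots&\Lambda_1E_n\end{bmatrix},\qquad b^w=\begin{bmatrix}b^w_2\\ b^w_3\\ \vdots\\ b^w_n\end{bmatrix},\qquad b^w_i=\Lambda_1(V_i^c)^T-\Lambda_i(V_1^c)^T .$$ Moreover, if $\xi^w$ is a solution and $V_1^d:=(\xi^w_1)^T$, then a coset weighted potential function $P$ is given by $P(s)=V^P(x_1\otimes\cdots\otimes x_n)$, where $x_j=\delta_{k_j}^{s_j}$ for $s=(s_1,\dots,s_n)\in S$ and $$V^P=(V_1^c-V_1^dE_1^T)\Lambda_1^{-1}.$$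
   Context: A finite normal form game $G=(N,S,C)$ has players $N=\{1,\dots,n\}$, strategy sets $S_i=\{1,\dots,k_i\}$ with $k_i\ge2$, profiles $S=\prod_i S_i$, $S_{-i}=\prod_{j\ne i}S_j$, and payoff functions $c_i:S\to\mathbb{R}$. Put $k=\prod_{j=1}^n k_j$. Let $\delta_m^j$ be the $j$-th column of the identity matrix $I_m$; for a profile $s=(s_1,\dots,s_n)$ put $x_j=\delta_{k_j}^{s_j}$. The structure vector of $c_i$ is the row vector $V_i^c\in\mathbb{R}^k$ with $c_i(s)=V_i^c(x_1\otimes\cdots\otimes x_n)$ for all $s\in S$. $G$ is a coset weighted potential game with weights $w_i:S_{-i}\to(0,\infty)$ if there is $P:S\to\mathbb{R}$ (a coset weighted potential function) such that for every $i\in N$, all $x,y\in S_i$ and all $s_{-i}\in S_{-i}$: $c_i(x,s_{-i})-c_i(y,s_{-i})=w_i(s_{-i})\,(P(x,s_{-i})-P(y,s_{-i}))$. The row vector $V_i^w\in\mathbb{R}^{k/k_i}$ (with positive entries) is defined by $w_i(s_{-i})=V_i^w\,\bigotimes_{j\ne i}x_j$ (factors in increasing order of $j$). $E_i:=I_{k_1\cdots k_{i-1}}\otimes\mathbf{1}_{k_i}\otimes I_{k_{i+1}\cdots k_n}$, a $k\times (k/k_i)$ matrix, where $\mathbf{1}_m$ is the all-ones column and empty products are $1$. $\Lambda_i$ is the $k\times k$ diagonal matrix whose diagonal entries are the entries of the row vector $V_i^wE_i^T\in\mathbb{R}^k$. *)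

theory Defs
  imports Complex_Main "HOL-Library.FuncSet" "Jordan_Normal_Form.Gauss_Jordan_Elimination"
begin

(* Row vectors are matrices with one row and column vectors are matrices with one column.
   Matrix indices start at 0, whereas players and strategies are numbered from 1. *)

section \<open>Kronecker products and block matrices\<close>

definition kron :: "'a::semiring_0 mat \<Rightarrow> 'a mat \<Rightarrow> 'a mat" where
  "kron A B = mat (dim_row A * dim_row B) (dim_col A * dim_col B)
     (\<lambda>(i, j). A $$ (i div dim_row B, j div dim_col B) * B $$ (i mod dim_row B, j mod dim_col B))"

definition kron_list :: "'a::semiring_1 mat list \<Rightarrow> 'a mat" where
  "kron_list As = foldr kron As (1\<^sub>m 1)"

definition append_cols :: "'a::zero mat \<Rightarrow> 'a mat \<Rightarrow> 'a mat" where
  "append_cols A B = four_block_mat A B (0\<^sub>m 0 (dim_col A)) (0\<^sub>m 0 (dim_col B))"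

(* The extra argument is the common number of rows (columns), needed for the empty list. *)
definition hstack :: "nat \<Rightarrow> 'a::zero mat list \<Rightarrow> 'a mat" where
  "hstack nr As = foldr append_cols As (0\<^sub>m nr 0)"

definition vstack :: "nat \<Rightarrow> 'a::zero mat list \<Rightarrow> 'a mat" where
  "vstack nc As = foldr append_rows As (0\<^sub>m 0 nc)"

definition ones_col :: "nat \<Rightarrow> real mat" where
  "ones_col m = mat m 1 (\<lambda>_. 1)"

definition delta :: "nat \<Rightarrow> nat \<Rightarrow> real mat" where
  "delta m j = mat_of_cols m [col (1\<^sub>m m) (j - 1)]"

section \<open>Coset weighted potential games\<close>

(* A game is given by the number n of players, the numbers k i of strategies and the payoff
   functions c i; its set of profiles is profiles k {1..n}. With s in opp_profiles n k i,
   the profile (x, s_-i) is s(i := x). *)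

definition profiles :: "(nat \<Rightarrow> nat) \<Rightarrow> nat set \<Rightarrow> (nat \<Rightarrow> nat) set" where
  "profiles k J = (\<Pi>\<^sub>E j\<in>J. {1..k j})"

definition opp_profiles :: "nat \<Rightarrow> (nat \<Rightarrow> nat) \<Rightarrow> nat \<Rightarrow> (nat \<Rightarrow> nat) set" where
  "opp_profiles n k i = profiles k ({1..n} - {i})"

definition coset_weighted_potential ::
  "nat \<Rightarrow> (nat \<Rightarrow> nat) \<Rightarrow> (nat \<Rightarrow> (nat \<Rightarrow> nat) \<Rightarrow> real) \<Rightarrow> (nat \<Rightarrow> (nat \<Rightarrow> nat) \<Rightarrow> real)
    \<Rightarrow> ((nat \<Rightarrow> nat) \<Rightarrow> real) \<Rightarrow> bool" where
  "coset_weighted_potential n k c w P \<longleftrightarrow>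
     (\<forall>i\<in>{1..n}. \<forall>x\<in>{1..k i}. \<forall>y\<in>{1..k i}. \<forall>s\<in>opp_profiles n k i.
        c i (s(i := x)) - c i (s(i := y)) = w i s * (P (s(i := x)) - P (s(i := y))))"

definition coset_weighted_potential_game ::
  "nat \<Rightarrow> (nat \<Rightarrow> nat) \<Rightarrow> (nat \<Rightarrow> (nat \<Rightarrow> nat) \<Rightarrow> real) \<Rightarrow> (nat \<Rightarrow> (nat \<Rightarrow> nat) \<Rightarrow> real)
    \<Rightarrow> bool" where
  "coset_weighted_potential_game n k c w \<longleftrightarrow> (\<exists>P. coset_weighted_potential n k c w P)"

section \<open>Structure vectors\<close>

definition players :: "nat \<Rightarrow> nat list" where
  "players n = [1..<Suc n]"

definition opponents :: "nat \<Rightarrow> nat \<Rightarrow> nat list" where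
  "opponents n i = filter (\<lambda>j. j \<noteq> i) (players n)"

definition joint_strategy :: "(nat \<Rightarrow> nat) \<Rightarrow> nat list \<Rightarrow> (nat \<Rightarrow> nat) \<Rightarrow> real mat" where
  "joint_strategy k js s = kron_list (map (\<lambda>j. delta (k j) (s j)) js)"

definition is_structure_vec ::
  "(nat \<Rightarrow> nat) \<Rightarrow> nat list \<Rightarrow> ((nat \<Rightarrow> nat) \<Rightarrow> real) \<Rightarrow> real mat \<Rightarrow> bool" where
  "is_structure_vec k js f V \<longleftrightarrow> V \<in> carrier_mat 1 (\<Prod>j\<leftarrow>js. k j) \<and>
     (\<forall>s\<in>profiles k (set js). f s = (V * joint_strategy k js s) $$ (0, 0))"

definition structure_vec :: "(nat \<Rightarrow> nat) \<Rightarrow> nat list \<Rightarrow> ((nat \<Rightarrow> nat) \<Rightarrow> real) \<Rightarrow> real mat" where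
  "structure_vec k js f = (THE V. is_structure_vec k js f V)"

lemma joint_strategy_unit_col:
  assumes "distinct js"
  shows "\<exists>h. bij_betw h (profiles k (set js)) {..<(\<Prod>j\<leftarrow>js. k j)} \<and>
    (\<forall>s\<in>profiles k (set js).
       joint_strategy k js s = mat_of_cols (\<Prod>j\<leftarrow>js. k j) [unit_vec (\<Prod>j\<leftarrow>js. k j) (h s)])"
  using assms
proof (induction js)
  case Nil
  have "joint_strategy k [] s = mat_of_cols 1 [unit_vec 1 0]" for s
    by (auto simp: joint_strategy_def kron_list_def mat_of_cols_def)
  then show ?case
    by (intro exI[of _ "\<lambda>_. 0"]) (auto simp: profiles_def bij_betw_def)
next
  case (Cons a js)
  let ?p = "\<Prod>j\<leftarrow>js. k j"
  let ?S = "profiles k (set js)" and ?T = "profiles k (set (a # js))"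
  have a: "a \<notin> set js" and d: "distinct js" using Cons.prems by auto
  obtain h where h: "bij_betw h ?S {..<?p}"
    and hs: "\<And>s. s \<in> ?S \<Longrightarrow> joint_strategy k js s = mat_of_cols ?p [unit_vec ?p (h s)]"
    using Cons.IH[OF d] by blast
  define r where "r s = restrict s (set js)" for s :: "nat \<Rightarrow> nat"
  define g where "g s = (s a - 1) * ?p + h (r s)" for s
  have r: "r s \<in> ?S" if "s \<in> ?T" for s
    using that by (auto simp: r_def profiles_def PiE_iff)
  have hlt: "h s < ?p" if "s \<in> ?S" for s using h that by (auto simp: bij_betw_def)
  have sa: "1 \<le> s a \<and> s a \<le> k a" if "s \<in> ?T" for s
    using that by (auto simp: profiles_def PiE_iff)
  have glt: "g s < k a * ?p" if s: "s \<in> ?T" for s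
  proof -
    have "g s < (s a - 1) * ?p + ?p" using hlt[OF r[OF s]] by (simp add: g_def)
    also have "\<dots> = s a * ?p" using sa[OF s] by (cases "s a") auto
    also have "\<dots> \<le> k a * ?p" using sa[OF s] by simp
    finally show ?thesis .
  qed
  have gdiv: "g s div ?p = s a - 1" "g s mod ?p = h (r s)" if "s \<in> ?T" for s
    using hlt[OF r[OF that]] by (auto simp: g_def)
  have inj: "inj_on g ?T"
  proof (rule inj_onI)
    fix s t assume s: "s \<in> ?T" and t: "t \<in> ?T" and eq: "g s = g t"
    have "s a - 1 = t a - 1" using gdiv(1)[OF s] gdiv(1)[OF t] eq by argo
    then have "s a = t a" using sa[OF s] sa[OF t] by linarith
    moreover have "r s = r t"
      using gdiv(2)[OF s] gdiv(2)[OF t] eq h r[OF s] r[OF t] by (auto simp: bij_betw_def inj_on_def)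
    ultimately have "s j = t j" if "j \<in> set (a # js)" for j
      using that by (auto simp: r_def fun_eq_iff restrict_def split: if_splits)
    then show "s = t" using s t unfolding profiles_def by (intro PiE_ext) auto
  qed
  have card: "card ?T = k a * ?p"
  proof -
    have "card ?T = (\<Prod>j\<in>set (a # js). card {1..k j})"
      unfolding profiles_def by (rule card_PiE) simp
    also have "\<dots> = prod_list (map k (a # js))"
      using Cons.prems by (subst prod.distinct_set_conv_list) auto
    finally show ?thesis by simp
  qed
  have bij: "bij_betw g ?T {..<k a * ?p}"
    unfolding bij_betw_def
  proof (intro conjI inj card_subset_eq)
    show "g ` ?T \<subseteq> {..<k a * ?p}" using glt by auto
    show "card (g ` ?T) = card {..<k a * ?p}" using card_image[OF inj] card by simp
  qed simp
  have "joint_strategy k (a # js) s = mat_of_cols (k a * ?p) [unit_vec (k a * ?p) (g s)]"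
    if s: "s \<in> ?T" for s
  proof -
    have "joint_strategy k js s = joint_strategy k js (r s)"
      unfolding joint_strategy_def by (rule arg_cong[of _ _ kron_list]) (simp add: r_def)
    moreover have "joint_strategy k (a # js) s = kron (delta (k a) (s a)) (joint_strategy k js s)"
      by (simp add: joint_strategy_def kron_list_def)
    ultimately have "joint_strategy k (a # js) s = kron (delta (k a) (s a)) (joint_strategy k js (r s))"
      by simp
    also have "\<dots> = kron (delta (k a) (s a)) (mat_of_cols ?p [unit_vec ?p (h (r s))])"
      using hs[OF r[OF s]] by simp
    also have "\<dots> = mat_of_cols (k a * ?p) [unit_vec (k a * ?p) (g s)]" (is "?L = ?R")
    proof (rule eq_matI)
      fix i j assume "i < dim_row ?R" "j < dim_col ?R"
      then have i: "i < k a * ?p" and j: "j = 0" by auto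
      have idiv: "i div ?p < k a" using i by (simp add: less_mult_imp_div_less)
      have "?p > 0" using i by (cases "?p") auto
      then have imod: "i mod ?p < ?p" by simp
      have "i = g s \<longleftrightarrow> i div ?p = s a - 1 \<and> i mod ?p = h (r s)"
        using gdiv[OF s] by (metis div_mult_mod_eq)
      then show "?L $$ (i, j) = ?R $$ (i, j)"
        using i j idiv imod sa[OF s] glt[OF s] hlt[OF r[OF s]]
        by (auto simp: kron_def delta_def mat_of_cols_def unit_vec_def)
    qed (auto simp: kron_def delta_def)
    finally show ?thesis .
  qed
  with bij show ?case by (intro exI[of _ g]) auto
qed

lemma row_times_unit_col:
  assumes "V \<in> carrier_mat 1 m" "r < m"
  shows "(V * mat_of_cols m [unit_vec m r]) $$ (0, 0) = (V $$ (0, r) :: real)"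
proof -
  have "col (mat_of_cols m [unit_vec m r]) 0 = (unit_vec m r :: real vec)"
    by (auto simp: mat_of_cols_def)
  then show ?thesis
    using assms scalar_prod_right_unit[of r m "row V 0"] by (auto simp: row_def)
qed

lemma structure_vec_ex1:
  assumes "distinct js"
  shows "\<exists>!V. is_structure_vec k js f V"
proof -
  let ?p = "\<Prod>j\<leftarrow>js. k j" and ?S = "profiles k (set js)"
  obtain h where h: "bij_betw h ?S {..<?p}"
    and hs: "\<And>s. s \<in> ?S \<Longrightarrow> joint_strategy k js s = mat_of_cols ?p [unit_vec ?p (h s)]"
    using joint_strategy_unit_col[OF assms] by blast
  have hlt: "h s < ?p" if "s \<in> ?S" for s using h that by (auto simp: bij_betw_def)
  have iff: "is_structure_vec k js f V \<longleftrightarrow>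
      V \<in> carrier_mat 1 ?p \<and> (\<forall>s\<in>?S. f s = V $$ (0, h s))" for V
    unfolding is_structure_vec_def using hs hlt row_times_unit_col by (metis (no_types, lifting))
  show ?thesis
  proof (rule ex1I)
    show "is_structure_vec k js f (mat 1 ?p (\<lambda>(_, r). f (inv_into ?S h r)))"
      unfolding iff using h hlt by (auto simp: bij_betw_def)
  next
    fix V assume V: "is_structure_vec k js f V"
    show "V = mat 1 ?p (\<lambda>(_, r). f (inv_into ?S h r))" (is "_ = ?W")
    proof (rule eq_matI)
      fix i j assume "i < dim_row ?W" "j < dim_col ?W"
      then have i: "i = 0" and j: "j < ?p" by auto
      have "inv_into ?S h j \<in> ?S" "h (inv_into ?S h j) = j"
        using h j by (auto simp: bij_betw_def inv_into_into f_inv_into_f)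
      then show "V $$ (i, j) = ?W $$ (i, j)" using V i j unfolding iff by fastforce
    qed (use V iff in auto)
  qed
qed

lemma structure_vec: "distinct js \<Longrightarrow> is_structure_vec k js f (structure_vec k js f)"
  unfolding structure_vec_def by (rule theI'[OF structure_vec_ex1])

definition payoff_vec ::
  "nat \<Rightarrow> (nat \<Rightarrow> nat) \<Rightarrow> (nat \<Rightarrow> (nat \<Rightarrow> nat) \<Rightarrow> real) \<Rightarrow> nat \<Rightarrow> real mat" where
  "payoff_vec n k c i = structure_vec k (players n) (c i)"

definition weight_vec ::
  "nat \<Rightarrow> (nat \<Rightarrow> nat) \<Rightarrow> (nat \<Rightarrow> (nat \<Rightarrow> nat) \<Rightarrow> real) \<Rightarrow> nat \<Rightarrow> real mat" where
  "weight_vec n k w i = structure_vec k (opponents n i) (w i)"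

section \<open>The linear system\<close>

definition num_profiles :: "nat \<Rightarrow> (nat \<Rightarrow> nat) \<Rightarrow> nat" where
  "num_profiles n k = (\<Prod>j=1..n. k j)"

definition E_mat :: "nat \<Rightarrow> (nat \<Rightarrow> nat) \<Rightarrow> nat \<Rightarrow> real mat" where
  "E_mat n k i = kron_list [1\<^sub>m (\<Prod>j\<in>{1..<i}. k j), ones_col (k i), 1\<^sub>m (\<Prod>j\<in>{i<..n}. k j)]"

definition Lambda_mat ::
  "nat \<Rightarrow> (nat \<Rightarrow> nat) \<Rightarrow> (nat \<Rightarrow> (nat \<Rightarrow> nat) \<Rightarrow> real) \<Rightarrow> nat \<Rightarrow> real mat" where
  "Lambda_mat n k w i = mat_diag (num_profiles n k)
     (\<lambda>r. (weight_vec n k w i * transpose_mat (E_mat n k i)) $$ (0, r))"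

definition Psi_block ::
  "nat \<Rightarrow> (nat \<Rightarrow> nat) \<Rightarrow> (nat \<Rightarrow> (nat \<Rightarrow> nat) \<Rightarrow> real) \<Rightarrow> nat \<Rightarrow> nat \<Rightarrow> real mat" where
  "Psi_block n k w i j =
     (if j = 1 then - (Lambda_mat n k w i * E_mat n k 1)
      else if j = i then Lambda_mat n k w 1 * E_mat n k i
      else 0\<^sub>m (num_profiles n k) (num_profiles n k div k j))"

definition Psi_mat :: "nat \<Rightarrow> (nat \<Rightarrow> nat) \<Rightarrow> (nat \<Rightarrow> (nat \<Rightarrow> nat) \<Rightarrow> real) \<Rightarrow> real mat" where
  "Psi_mat n k w = vstack (\<Sum>j=1..n. num_profiles n k div k j)
     (map (\<lambda>i. hstack (num_profiles n k) (map (Psi_block n k w i) [1..<Suc n])) [2..<Suc n])"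

definition b_block ::
  "nat \<Rightarrow> (nat \<Rightarrow> nat) \<Rightarrow> (nat \<Rightarrow> (nat \<Rightarrow> nat) \<Rightarrow> real) \<Rightarrow> (nat \<Rightarrow> (nat \<Rightarrow> nat) \<Rightarrow> real)
    \<Rightarrow> nat \<Rightarrow> real mat" where
  "b_block n k c w i = Lambda_mat n k w 1 * transpose_mat (payoff_vec n k c i)
     - Lambda_mat n k w i * transpose_mat (payoff_vec n k c 1)"

definition b_vec ::
  "nat \<Rightarrow> (nat \<Rightarrow> nat) \<Rightarrow> (nat \<Rightarrow> (nat \<Rightarrow> nat) \<Rightarrow> real) \<Rightarrow> (nat \<Rightarrow> (nat \<Rightarrow> nat) \<Rightarrow> real)
    \<Rightarrow> real mat" where
  "b_vec n k c w = vstack 1 (map (b_block n k c w) [2..<Suc n])"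

(* xi is the family of blocks xi 1, ..., xi n of the unknown. *)
definition solves_system ::
  "nat \<Rightarrow> (nat \<Rightarrow> nat) \<Rightarrow> (nat \<Rightarrow> (nat \<Rightarrow> nat) \<Rightarrow> real) \<Rightarrow> (nat \<Rightarrow> (nat \<Rightarrow> nat) \<Rightarrow> real)
    \<Rightarrow> (nat \<Rightarrow> real mat) \<Rightarrow> bool" where
  "solves_system n k c w \<xi> \<longleftrightarrow>
     (\<forall>i\<in>{1..n}. \<xi> i \<in> carrier_mat (num_profiles n k div k i) 1) \<and>
     Psi_mat n k w * vstack 1 (map \<xi> [1..<Suc n]) = b_vec n k c w"

end

(* The row of E_i at the position of a profile s is the unit vector at the position of s_-i.
   Read off at s, the i-th block of the system is therefore
     w_1(s_-1) (c_i(s) - xi_i(s_-i)) = w_i(s_-i) (c_1(s) - xi_1(s_-1)).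
   Given a potential P, the function xi_i(s_-i) = c_i(s) - w_i(s_-i) P(s) does not depend on s_i
   and solves the system. Given a solution, P(s) = (c_1(s) - xi_1(s_-1)) / w_1(s_-1) satisfies
   c_i(s) - xi_i(s_-i) = w_i(s_-i) P(s) for all i, so xi_i cancels in differences. *)

theory Submission
  imports Defs
begin

section \<open>Calculus of stacked blocks, unit vector rows and inverses of diagonal
  matrices\<close>

section \<open>Block matrices\<close>

text \<open>Both factors are four-block matrices whose lower or right blocks are empty, so the block
  product has three blocks without entries and only the upper left one remains.\<close>

lemma append_cols_mult_append_rows:
  fixes A B X Y :: "'a::semiring_0 mat"
  assumes "A \<in> carrier_mat nr a" "B \<in> carrier_mat nr b" "X \<in> carrier_mat a nc" "Y \<in> carrier_mat b nc"
  shows "append_cols A B * append_rows X Y = A * X + B * Y"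
proof -
  have d: "dim_col A = a" "dim_col B = b" "dim_row X = a" "dim_row Y = b"
    using assms by auto
  have "append_cols A B * append_rows X Y =
    four_block_mat (A * X + B * Y) (A * 0\<^sub>m a 0 + B * 0\<^sub>m b 0)
      (0\<^sub>m 0 a * X + 0\<^sub>m 0 b * Y) (0\<^sub>m 0 a * 0\<^sub>m a 0 + 0\<^sub>m 0 b * 0\<^sub>m b 0)"
    unfolding append_cols_def append_rows_def d using assms
    by (intro mult_four_block_mat) auto
  also have "\<dots> = A * X + B * Y"
    using assms by (intro eq_matI) auto
  finally show ?thesis .
qed

lemma append_rows_mult:
  fixes A B X :: "'a::semiring_0 mat"
  assumes "A \<in> carrier_mat ra m" "B \<in> carrier_mat rb m" "X \<in> carrier_mat m nc"
  shows "append_rows A B * X = append_rows (A * X) (B * X)"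
  using assms unfolding append_rows_def
  by (intro eq_matI) (auto simp: scalar_prod_def intro!: sum.cong)

lemma append_rows_eq_iff:
  assumes "A \<in> carrier_mat ra nc" "A' \<in> carrier_mat ra nc" "B \<in> carrier_mat rb nc" "B' \<in> carrier_mat rb nc"
  shows "append_rows A B = append_rows A' B' \<longleftrightarrow> A = A' \<and> B = B'"
proof
  assume eq: "append_rows A B = append_rows A' B'"
  have "A $$ (i, j) = A' $$ (i, j)" if "i < ra" "j < nc" for i j
    using arg_cong[OF eq, of "\<lambda>M. M $$ (i, j)"] that assms by (auto simp: append_rows_def)
  moreover have "B $$ (i, j) = B' $$ (i, j)" if "i < rb" "j < nc" for i j
    using arg_cong[OF eq, of "\<lambda>M. M $$ (ra + i, j)"] that assms by (auto simp: append_rows_def)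
  ultimately show "A = A' \<and> B = B'"
    using assms by (auto intro!: eq_matI)
qed auto

lemma hstack_carrier:
  assumes "\<And>j. j \<in> set js \<Longrightarrow> F j \<in> carrier_mat nr (d j)"
  shows "hstack nr (map F js) \<in> carrier_mat nr (\<Sum>j\<leftarrow>js. d j)"
  using assms
proof (induction js)
  case (Cons a js)
  then have "F a \<in> carrier_mat nr (d a)" "hstack nr (map F js) \<in> carrier_mat nr (\<Sum>j\<leftarrow>js. d j)"
    by auto
  then show ?case
    by (auto simp: hstack_def append_cols_def)
qed (simp add: hstack_def)

lemma vstack_carrier:
  assumes "\<And>j. j \<in> set js \<Longrightarrow> X j \<in> carrier_mat (d j) nc"
  shows "vstack nc (map X js) \<in> carrier_mat (\<Sum>j\<leftarrow>js. d j) nc"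
  using assms by (induction js) (auto simp: vstack_def)

text \<open>Induction splits off one block at a time. Summing entrywise inside
  \<open>mat nr nc\<close> keeps the dimensions fixed even for the empty list.\<close>

lemma hstack_mult_vstack:
  fixes F X :: "'b \<Rightarrow> 'a::semiring_0 mat"
  assumes "\<And>j. j \<in> set js \<Longrightarrow> F j \<in> carrier_mat nr (d j)"
    and "\<And>j. j \<in> set js \<Longrightarrow> X j \<in> carrier_mat (d j) nc"
  shows "hstack nr (map F js) * vstack nc (map X js) =
    mat nr nc (\<lambda>(r, q). \<Sum>j\<leftarrow>js. (F j * X j) $$ (r, q))"
  using assms
proof (induction js)
  case Nil
  show ?case by (rule eq_matI) (auto simp: hstack_def vstack_def)
next
  case (Cons a js)
  have "hstack nr (map F (a # js)) * vstack nc (map X (a # js)) =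
      F a * X a + hstack nr (map F js) * vstack nc (map X js)"
    using append_cols_mult_append_rows[of "F a" nr "d a" "hstack nr (map F js)" "\<Sum>j\<leftarrow>js. d j" "X a" nc
        "vstack nc (map X js)"] hstack_carrier[of js F nr d] vstack_carrier[of js X d nc] Cons.prems
    by (simp add: hstack_def vstack_def)
  also have "\<dots> = F a * X a + mat nr nc (\<lambda>(r, q). \<Sum>j\<leftarrow>js. (F j * X j) $$ (r, q))"
    using Cons.prems by (subst Cons.IH) auto
  also have "\<dots> = mat nr nc (\<lambda>(r, q). \<Sum>j\<leftarrow>a # js. (F j * X j) $$ (r, q))"
    using Cons.prems(1)[of a] Cons.prems(2)[of a] by (intro eq_matI) auto
  finally show ?case .
qed

lemma vstack_mult:
  fixes F :: "'b \<Rightarrow> 'a::semiring_0 mat"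
  assumes "\<And>i. i \<in> set is \<Longrightarrow> F i \<in> carrier_mat (d i) m" "X \<in> carrier_mat m nc"
  shows "vstack m (map F is) * X = vstack nc (map (\<lambda>i. F i * X) is)"
  using assms(1)
proof (induction "is")
  case Nil
  show ?case using assms(2) by (auto simp: vstack_def)
next
  case (Cons a js)
  then show ?case
    using append_rows_mult[of "F a" "d a" m "vstack m (map F js)" "\<Sum>j\<leftarrow>js. d j" X nc]
      vstack_carrier[of js F d m] assms(2)
    by (simp add: vstack_def)
qed

text \<open>Blocks with the same index have the same height \<open>d i\<close>, so the two stacks
  line up. This splits the system into one matrix equation per player i = 2, ..., n.\<close>

lemma vstack_eq_iff:
  assumes "\<And>i. i \<in> set is \<Longrightarrow> F i \<in> carrier_mat (d i) nc"
    and "\<And>i. i \<in> set is \<Longrightarrow> G i \<in> carrier_mat (d i) nc"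
  shows "vstack nc (map F is) = vstack nc (map G is) \<longleftrightarrow> (\<forall>i\<in>set is. F i = G i)"
  using assms
proof (induction "is")
  case (Cons a js)
  then show ?case
    using append_rows_eq_iff[of "F a" "d a" nc "G a" "vstack nc (map F js)" "\<Sum>j\<leftarrow>js. d j"
        "vstack nc (map G js)"] vstack_carrier[of js F d nc] vstack_carrier[of js G d nc]
    by (simp add: vstack_def)
qed (simp add: vstack_def)

text \<open>Only one term of the product sum survives. Applied to E_i, it shows that the product
  copies the entry belonging to s_-i.\<close>

lemma mult_mat_row_indicator:
  fixes A X :: "'a::semiring_1 mat"
  assumes "A \<in> carrier_mat nr m" "X \<in> carrier_mat m nc" "r < nr" "q < nc" "p < m"
    and "\<And>j. j < m \<Longrightarrow> A $$ (r, j) = (if j = p then 1 else 0)"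
  shows "(A * X) $$ (r, q) = X $$ (p, q)"
proof -
  have "(A * X) $$ (r, q) = (\<Sum>j<m. A $$ (r, j) * X $$ (j, q))"
    using assms(1-4) by (auto simp: scalar_prod_def lessThan_atLeast0)
  also have "\<dots> = (\<Sum>j<m. if j = p then X $$ (j, q) else 0)"
    using assms(6) by (intro sum.cong) auto
  also have "\<dots> = X $$ (p, q)"
    using assms(5) by simp
  finally show ?thesis .
qed

text \<open>Removes the one-by-one identity with which the fold in \<open>kron_list\<close>
  ends.\<close>

lemma kron_one_right: "kron A (1\<^sub>m 1 :: 'a::semiring_1 mat) = A"
  by (rule eq_matI) (auto simp: kron_def)

text \<open>\<open>mat_inverse\<close> is given by Gauss-Jordan elimination, not by a formula. The
  reciprocal diagonal is a two-sided inverse, so elimination succeeds, and uniqueness of inverses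
  identifies its result.\<close>

lemma mat_inverse_mat_diag:
  fixes f :: "nat \<Rightarrow> 'a::field"
  assumes "\<And>i. i < m \<Longrightarrow> f i \<noteq> 0"
  shows "mat_inverse (mat_diag m f) = Some (mat_diag m (\<lambda>i. inverse (f i)))"
proof -
  let ?A = "mat_diag m f" and ?B = "mat_diag m (\<lambda>i. inverse (f i))"
  have AB: "?A * ?B = 1\<^sub>m m" "?B * ?A = 1\<^sub>m m"
    using assms unfolding mat_diag_diag by (auto simp: mat_diag_def intro!: eq_matI)
  then have "?A \<in> Units (ring_mat TYPE('a) m ())"
    by (auto simp: Units_def ring_mat_def intro!: bexI[of _ ?B])
  then obtain C where C: "mat_inverse ?A = Some C"
    using mat_inverse(1)[of ?A m "()"] by (cases "mat_inverse ?A") auto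
  then have CA: "C * ?A = 1\<^sub>m m" "C \<in> carrier_mat m m"
    using mat_inverse(2)[of ?A m C] by auto
  have "C = C * (?A * ?B)"
    using AB CA by simp
  also have "\<dots> = C * ?A * ?B"
    using CA(2) by (intro assoc_mult_mat[symmetric, of _ m m _ m _ m]) auto
  also have "\<dots> = ?B"
    using CA(1) by (simp add: left_mult_one_mat[of _ m m])
  finally show ?thesis
    using C by simp
qed

section \<open>Explicit index of a joint strategy in a Kronecker product\<close>

section \<open>Mixed radix positions of profiles\<close>

text \<open>The first listed player is the most significant digit, as in the order of Kronecker
  factors. Strategies start at 1 and matrix indices at 0, hence the digit
  \<open>s a - 1\<close>.\<close>

primrec rank :: "(nat \<Rightarrow> nat) \<Rightarrow> nat list \<Rightarrow> (nat \<Rightarrow> nat) \<Rightarrow> nat" where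
  "rank k [] s = 0"
| "rank k (a # js) s = (s a - 1) * (\<Prod>j\<leftarrow>js. k j) + rank k js s"

text \<open>Used to compare the positions of s and s_-i, whose player lists share the parts before
  and after i.\<close>

lemma rank_append: "rank k (as @ bs) s = rank k as s * (\<Prod>j\<leftarrow>bs. k j) + rank k bs s"
  by (induction as) (auto simp: algebra_simps)

lemma rank_cong: "(\<And>j. j \<in> set js \<Longrightarrow> s j = t j) \<Longrightarrow> rank k js s = rank k js t"
  by (induction js) auto

lemma rank_less:
  "(\<And>j. j \<in> set js \<Longrightarrow> s j \<in> {1..k j}) \<Longrightarrow> rank k js s < (\<Prod>j\<leftarrow>js. k j)"
proof (induction js)
  case (Cons a js)
  let ?p = "\<Prod>j\<leftarrow>js. k j"
  have "rank k (a # js) s < (s a - 1) * ?p + ?p"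
    using Cons by simp
  \<comment> \<open>\<open>s a\<close> is at least 1, so the natural subtraction in the digit does
    not truncate.\<close>
  also have "\<dots> = s a * ?p"
    using Cons.prems[of a] by (cases "s a") auto
  also have "\<dots> \<le> k a * ?p"
    using Cons.prems[of a] by simp
  finally show ?case by simp
qed simp

text \<open>A Kronecker product of unit columns is a unit column; its index has the two factor
  indices as quotient and remainder modulo the size of the second factor. In contrast to
  \<open>joint_strategy_unit_col\<close>, the bijection is now explicit.\<close>

lemma joint_strategy_rank:
  assumes "\<And>j. j \<in> set js \<Longrightarrow> s j \<in> {1..k j}"
  shows "joint_strategy k js s = mat_of_cols (\<Prod>j\<leftarrow>js. k j) [unit_vec (\<Prod>j\<leftarrow>js. k j) (rank k js s)]"
  using assms
proof (induction js)
  case Nil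
  show ?case by (auto simp: joint_strategy_def kron_list_def mat_of_cols_def)
next
  case (Cons a js)
  let ?p = "\<Prod>j\<leftarrow>js. k j"
  have lt: "rank k js s < ?p"
    using Cons.prems by (intro rank_less) auto
  have g: "rank k (a # js) s div ?p = s a - 1" "rank k (a # js) s mod ?p = rank k js s"
    using lt by auto
  have glt: "rank k (a # js) s < k a * ?p"
    using rank_less[of "a # js" s k] Cons.prems by auto
  have "joint_strategy k (a # js) s =
      kron (delta (k a) (s a)) (mat_of_cols ?p [unit_vec ?p (rank k js s)])"
    using Cons by (simp add: joint_strategy_def kron_list_def)
  also have "\<dots> = mat_of_cols (k a * ?p) [unit_vec (k a * ?p) (rank k (a # js) s)]" (is "?L = ?R")
  proof (rule eq_matI)
    fix i j assume "i < dim_row ?R" "j < dim_col ?R"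
    then have i: "i < k a * ?p" and j: "j = 0" by auto
    have idiv: "i div ?p < k a"
      using i by (simp add: less_mult_imp_div_less)
    have imod: "i mod ?p < ?p"
      using lt by simp
    have "i = rank k (a # js) s \<longleftrightarrow> i div ?p = s a - 1 \<and> i mod ?p = rank k js s"
      using g by (metis div_mult_mod_eq)
    then show "?L $$ (i, j) = ?R $$ (i, j)"
      using i j idiv imod Cons.prems[of a] glt lt
      by (auto simp: kron_def delta_def mat_of_cols_def unit_vec_def)
  qed (auto simp: kron_def delta_def)
  finally show ?case by simp
qed

lemma row_times_joint_strategy:
  assumes "V \<in> carrier_mat 1 (\<Prod>j\<leftarrow>js. k j)" "\<And>j. j \<in> set js \<Longrightarrow> s j \<in> {1..k j}"
  shows "(V * joint_strategy k js s) $$ (0, 0) = V $$ (0, rank k js s)"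
  using assms by (simp add: joint_strategy_rank row_times_unit_col rank_less)

text \<open>The bijection \<open>h\<close> and \<open>rank\<close> locate the single 1 of the same
  column, so they agree and \<open>rank\<close> inherits surjectivity.\<close>

lemma rank_surj:
  assumes "distinct js" "r < (\<Prod>j\<leftarrow>js. k j)"
  obtains s where "s \<in> profiles k (set js)" "rank k js s = r"
proof -
  let ?p = "\<Prod>j\<leftarrow>js. k j"
  obtain h where h: "bij_betw h (profiles k (set js)) {..<?p}"
    and hs: "\<And>s. s \<in> profiles k (set js) \<Longrightarrow> joint_strategy k js s = mat_of_cols ?p [unit_vec ?p (h s)]"
    using joint_strategy_unit_col[OF assms(1)] by blast
  have "r \<in> h ` profiles k (set js)"
    using h assms(2) by (simp add: bij_betw_def)
  then obtain s where s: "s \<in> profiles k (set js)" "h s = r"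
    by blast
  have rng: "s j \<in> {1..k j}" if "j \<in> set js" for j
    using s that unfolding profiles_def by (auto simp: PiE_iff)
  have "mat_of_cols ?p [unit_vec ?p (rank k js s)] = (mat_of_cols ?p [unit_vec ?p r] :: real mat)"
    using hs[OF s(1)] joint_strategy_rank[OF rng] s(2) by simp
  from arg_cong[OF this, of "\<lambda>M. M $$ (r, 0)"] have "rank k js s = r"
    using assms(2) rank_less[OF rng] by (auto simp: mat_of_cols_def unit_vec_def split: if_splits)
  with s that show ?thesis by blast
qed

lemma structure_vec_carrier:
  "distinct js \<Longrightarrow> structure_vec k js f \<in> carrier_mat 1 (\<Prod>j\<leftarrow>js. k j)"
  using structure_vec[of js k f] by (simp add: is_structure_vec_def)

lemma structure_vec_index:
  assumes "distinct js" "s \<in> profiles k (set js)"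
  shows "structure_vec k js f $$ (0, rank k js s) = f s"
proof -
  have "s j \<in> {1..k j}" if "j \<in> set js" for j
    using assms(2) that unfolding profiles_def by (auto simp: PiE_iff)
  then show ?thesis
    using structure_vec[OF assms(1), of k f] assms row_times_joint_strategy[of "structure_vec k js f" k js s]
    by (auto simp: is_structure_vec_def)
qed

section \<open>Player lists and their products of strategy numbers\<close>

section \<open>The system in terms of profiles\<close>

lemma distinct_players [simp]: "distinct (players n)" "distinct (opponents n i)"
  by (auto simp: players_def opponents_def)

lemma set_players [simp]: "set (players n) = {1..n}" "set (opponents n i) = {1..n} - {i}"
  by (auto simp: players_def opponents_def)

lemma players_split:
  assumes "i \<in> {1..n}"
  shows "players n = [1..<i] @ i # [Suc i..<Suc n]" "opponents n i = [1..<i] @ [Suc i..<Suc n]"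
proof -
  show p: "players n = [1..<i] @ i # [Suc i..<Suc n]"
    using assms upt_add_eq_append[of 1 i "Suc n - i"] upt_conv_Cons[of i "Suc n"]
    by (auto simp: players_def simp del: upt_Suc)
  have "filter (\<lambda>j. j \<noteq> i) [1..<i] = [1..<i]" "filter (\<lambda>j. j \<noteq> i) [Suc i..<Suc n] = [Suc i..<Suc n]"
    by (auto simp: filter_id_conv simp del: upt_Suc)
  then show "opponents n i = [1..<i] @ [Suc i..<Suc n]"
    by (simp add: opponents_def p del: upt_Suc)
qed

lemma prod_players: "(\<Prod>j\<leftarrow>players n. k j) = num_profiles n k"
  unfolding num_profiles_def by (simp flip: prod.distinct_set_conv_list)

lemma prod_opponents:
  assumes "i \<in> {1..n}" "k i > 0"
  shows "(\<Prod>j\<leftarrow>opponents n i. k j) = num_profiles n k div k i"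
  using assms unfolding prod_players[symmetric] players_split[OF assms(1)]
  by (simp add: mult.left_commute del: upt_Suc)

section \<open>A fixed game: profiles, opposing profiles and their positions\<close>

locale coset_weighted_game =
  fixes n :: nat and k :: "nat \<Rightarrow> nat" and c w :: "nat \<Rightarrow> (nat \<Rightarrow> nat) \<Rightarrow> real"
  assumes two_players: "n \<ge> 2"
    and strategies_pos: "i \<in> {1..n} \<Longrightarrow> k i > 0"
    and weight_pos: "i \<in> {1..n} \<Longrightarrow> s \<in> opp_profiles n k i \<Longrightarrow> w i s > 0"
begin

abbreviation "K \<equiv> num_profiles n k"
abbreviation "pos \<equiv> rank k (players n)"
abbreviation "opp_pos i \<equiv> rank k (opponents n i)"
abbreviation "opp i s \<equiv> restrict s ({1..n} - {i})"
abbreviation "\<Lambda> \<equiv> Lambda_mat n k w"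

text \<open>Lifts w_i to full profiles, at which the equations are read off. The restriction is
  there because members of \<open>opp_profiles\<close> are extensional functions.\<close>

definition weight :: "nat \<Rightarrow> (nat \<Rightarrow> nat) \<Rightarrow> real" where
  "weight i s = w i (opp i s)"

lemma profile_range: "s \<in> profiles k {1..n} \<Longrightarrow> j \<in> {1..n} \<Longrightarrow> s j \<in> {1..k j}"
  unfolding profiles_def by (auto simp: PiE_iff)

lemma opp_in_opp_profiles: "s \<in> profiles k {1..n} \<Longrightarrow> opp i s \<in> opp_profiles n k i"
  unfolding opp_profiles_def profiles_def by (auto simp: PiE_iff)

lemma weight_profile_pos: "i \<in> {1..n} \<Longrightarrow> s \<in> profiles k {1..n} \<Longrightarrow> weight i s > 0"
  unfolding weight_def by (intro weight_pos opp_in_opp_profiles)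

lemma fun_upd_in_profiles:
  assumes "i \<in> {1..n}" "s \<in> opp_profiles n k i" "x \<in> {1..k i}"
  shows "s(i := x) \<in> profiles k {1..n}"
  using assms unfolding opp_profiles_def profiles_def
  by (auto simp: PiE_iff extensional_def)

lemma opp_fun_upd: "s \<in> opp_profiles n k i \<Longrightarrow> opp i (s(i := x)) = s"
  unfolding opp_profiles_def profiles_def by (auto simp: PiE_iff extensional_def fun_eq_iff)

lemma opp_pos_opp: "opp_pos i (opp i s) = opp_pos i s"
  by (rule rank_cong) auto

text \<open>The position does not look at player i, so a deviation of i leaves the entry of xi_i
  unchanged.\<close>

lemma opp_pos_fun_upd: "opp_pos i (s(i := x)) = opp_pos i s"
  by (rule rank_cong) auto

lemma pos_less: "s \<in> profiles k {1..n} \<Longrightarrow> pos s < K"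
  using rank_less[of "players n" s k] profile_range[of s] by (simp add: prod_players)

lemma opp_pos_less: "i \<in> {1..n} \<Longrightarrow> s \<in> profiles k {1..n} \<Longrightarrow> opp_pos i s < K div k i"
  using rank_less[of "opponents n i" s k] profile_range[of s] strategies_pos[of i]
  by (simp add: prod_opponents)

text \<open>Every row index belongs to a profile, so matrix equations can be tested at
  profiles.\<close>

lemma pos_surj:
  assumes "r < K"
  obtains s where "s \<in> profiles k {1..n}" "pos s = r"
  using rank_surj[of "players n" r k] assms by (auto simp: prod_players)

section \<open>Entries of structure vectors and of the matrices E_i\<close>

lemma payoff_vec_carrier: "payoff_vec n k c i \<in> carrier_mat 1 K"
  using structure_vec_carrier[of "players n" k "c i"] by (simp add: payoff_vec_def prod_players)

lemma payoff_vec_index: "s \<in> profiles k {1..n} \<Longrightarrow> payoff_vec n k c i $$ (0, pos s) = c i s"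
  by (simp add: payoff_vec_def structure_vec_index)

lemma opp_structure_vec_carrier:
  "i \<in> {1..n} \<Longrightarrow> structure_vec k (opponents n i) f \<in> carrier_mat 1 (K div k i)"
  using structure_vec_carrier[of "opponents n i" k f] strategies_pos[of i] by (simp add: prod_opponents)

lemma opp_structure_vec_index:
  assumes "s \<in> profiles k {1..n}"
  shows "structure_vec k (opponents n i) f $$ (0, opp_pos i s) = f (opp i s)"
  using structure_vec_index[of "opponents n i" "opp i s" k f] opp_in_opp_profiles[OF assms, of i]
  by (simp add: opp_pos_opp opp_profiles_def del: One_nat_def)

text \<open>Write \<open>pos s\<close> with digits \<open>ra\<close>, \<open>x\<close>,
  \<open>rb\<close> for the players before i, for i, and after i. The identity factors force the
  column to have outer digits \<open>ra\<close> and \<open>rb\<close>, while the column of ones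
  accepts every \<open>x\<close>; the only such column is the position of s_-i.\<close>

lemma E_mat_carrier_index:
  assumes i: "i \<in> {1..n}"
  shows E_mat_carrier: "E_mat n k i \<in> carrier_mat K (K div k i)"
    and E_mat_index: "s \<in> profiles k {1..n} \<Longrightarrow> q < K div k i \<Longrightarrow>
      E_mat n k i $$ (pos s, q) = (if q = opp_pos i s then 1 else 0)"
proof -
  let ?as = "[1..<i]" and ?bs = "[Suc i..<Suc n]"
  define a b where "a = (\<Prod>j\<leftarrow>?as. k j)" and "b = (\<Prod>j\<leftarrow>?bs. k j)"
  have E: "E_mat n k i = kron (1\<^sub>m a) (kron (ones_col (k i)) (1\<^sub>m b))"
  proof -
    have "{1..<i} = set ?as" "{i<..n} = set ?bs"
      by auto
    then have "(\<Prod>j\<in>{1..<i}. k j) = a" "(\<Prod>j\<in>{i<..n}. k j) = b"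
      unfolding a_def b_def by (simp_all only: prod.distinct_set_conv_list distinct_upt)
    then show ?thesis
      by (simp add: E_mat_def kron_list_def kron_one_right del: One_nat_def)
  qed
  have K: "K = a * (k i * b)"
    unfolding prod_players[symmetric] players_split[OF i] a_def b_def by (simp del: upt_Suc)
  have Ki: "K div k i = a * b"
    unfolding prod_opponents[of i n k, OF i strategies_pos[OF i], symmetric] players_split[OF i] a_def b_def
    by (simp del: upt_Suc)
  show "E_mat n k i \<in> carrier_mat K (K div k i)"
    unfolding Ki unfolding E K by (simp add: kron_def ones_col_def)
  show "E_mat n k i $$ (pos s, q) = (if q = opp_pos i s then 1 else 0)"
    if s: "s \<in> profiles k {1..n}" and q: "q < K div k i"
  proof -
    define ra x rb where "ra = rank k ?as s" and "x = s i - 1" and "rb = rank k ?bs s"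
    have ra: "ra < a" and rb: "rb < b"
      unfolding ra_def rb_def a_def b_def using profile_range[OF s] i
      by (intro rank_less; auto simp del: upt_Suc)+
    have x: "x < k i"
      unfolding x_def using profile_range[OF s i] by auto
    have p: "pos s = ra * (k i * b) + (x * b + rb)"
      unfolding players_split[OF i] rank_append by (simp add: ra_def x_def rb_def b_def del: upt_Suc)
    have op: "opp_pos i s = ra * b + rb"
      unfolding players_split[OF i] rank_append by (simp add: ra_def rb_def b_def del: upt_Suc)
    have xb: "x * b + rb < k i * b"
    proof -
      have "x * b + rb < Suc x * b" using rb by simp
      also have "\<dots> \<le> k i * b" using x by (intro mult_le_mono1) simp
      finally show ?thesis .
    qed
    \<comment> \<open>The inner Kronecker factor has \<open>k i * b\<close> rows, which is the
      modulus separating \<open>ra\<close> from the lower digits.\<close>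
    have d: "pos s div (k i * b) = ra" "pos s mod (k i * b) = x * b + rb"
    proof -
      have "(u * m + v) div m = u \<and> (u * m + v) mod m = v" if "v < m" for u v m :: nat
        using that by simp
      from this[OF xb] show "pos s div (k i * b) = ra" "pos s mod (k i * b) = x * b + rb"
        unfolding p by blast+
    qed
    have d': "(x * b + rb) div b = x" "(x * b + rb) mod b = rb"
      using rb by auto
    have qd: "q div b < a" "q mod b < b"
      using q rb unfolding Ki by (auto simp: less_mult_imp_div_less)
    have "q = opp_pos i s \<longleftrightarrow> q div b = ra \<and> q mod b = rb"
      unfolding op using rb div_mult_mod_eq[of q b] by auto
    then show ?thesis
      using pos_less[OF s] q ra rb x xb qd unfolding K Ki E
      by (auto simp: kron_def ones_col_def d d')
  qed
qed

lemma E_mat_mult_index: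
  assumes "i \<in> {1..n}" "s \<in> profiles k {1..n}" "X \<in> carrier_mat (K div k i) 1"
  shows "(E_mat n k i * X) $$ (pos s, 0) = X $$ (opp_pos i s, 0)"
  using assms pos_less opp_pos_less E_mat_index
  by (intro mult_mat_row_indicator[OF E_mat_carrier]) auto

text \<open>Transposing reduces this to \<open>E_mat_mult_index\<close>: right multiplication by
  E_i^T lifts a function of s_-i to full profiles.\<close>

lemma mult_transpose_E_mat_index:
  assumes "i \<in> {1..n}" "s \<in> profiles k {1..n}" "V \<in> carrier_mat 1 (K div k i)"
  shows "(V * transpose_mat (E_mat n k i)) $$ (0, pos s) = V $$ (0, opp_pos i s)"
proof -
  have "V * transpose_mat (E_mat n k i) = transpose_mat (E_mat n k i * transpose_mat V)"
    using transpose_mult[OF E_mat_carrier[OF assms(1)], of "transpose_mat V" 1] assms(3) by simp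
  then show ?thesis
    using E_mat_mult_index[OF assms(1,2), of "transpose_mat V"] assms E_mat_carrier[OF assms(1)]
      pos_less[OF assms(2)] opp_pos_less[OF assms(1,2)]
    by simp
qed

section \<open>The diagonal matrices Lambda_i and their inverses\<close>

lemma Lambda_mat_carrier: "\<Lambda> i \<in> carrier_mat K K"
  by (simp add: Lambda_mat_def)

lemma Lambda_diag_index:
  assumes "i \<in> {1..n}" "s \<in> profiles k {1..n}"
  shows "(weight_vec n k w i * transpose_mat (E_mat n k i)) $$ (0, pos s) = weight i s"
  using assms mult_transpose_E_mat_index[OF assms] opp_structure_vec_carrier[OF assms(1)]
  by (simp add: weight_vec_def weight_def opp_structure_vec_index)

lemma Lambda_mult_index:
  assumes "i \<in> {1..n}" "s \<in> profiles k {1..n}" "X \<in> carrier_mat K m" "q < m"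
  shows "(\<Lambda> i * X) $$ (pos s, q) = weight i s * X $$ (pos s, q)"
  using assms pos_less[OF assms(2)] Lambda_diag_index[OF assms(1,2)]
  by (simp add: Lambda_mat_def mat_diag_mult_left)

text \<open>Each diagonal entry sits at the position of some profile, where it is a positive weight.
  Hence Lambda_i is invertible and its inverse divides entry by entry.\<close>

lemma mult_inverse_Lambda_index:
  assumes "i \<in> {1..n}" "s \<in> profiles k {1..n}" "V \<in> carrier_mat 1 K"
  shows "V * the (mat_inverse (\<Lambda> i)) \<in> carrier_mat 1 K"
    and "(V * the (mat_inverse (\<Lambda> i))) $$ (0, pos s) = V $$ (0, pos s) / weight i s"
proof -
  let ?f = "\<lambda>r. (weight_vec n k w i * transpose_mat (E_mat n k i)) $$ (0, r)"
  have "?f r \<noteq> 0" if "r < K" for r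
  proof -
    obtain t where t: "t \<in> profiles k {1..n}" "pos t = r"
      using \<open>r < K\<close> by (rule pos_surj)
    show ?thesis
      using Lambda_diag_index[OF assms(1) t(1)] weight_profile_pos[OF assms(1) t(1)] t(2) by simp
  qed
  then have inv: "the (mat_inverse (\<Lambda> i)) = mat_diag K (\<lambda>r. inverse (?f r))"
    by (simp add: Lambda_mat_def mat_inverse_mat_diag)
  show "V * the (mat_inverse (\<Lambda> i)) \<in> carrier_mat 1 K"
    unfolding inv using assms(3) by auto
  show "(V * the (mat_inverse (\<Lambda> i))) $$ (0, pos s) = V $$ (0, pos s) / weight i s"
    unfolding inv using assms(3) pos_less[OF assms(2)] Lambda_diag_index[OF assms(1,2)]
    by (simp add: mat_diag_mult_right divide_inverse)
qed

section \<open>The blocks of Psi_w and b^w, and the system as scalar equations\<close>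

lemma Psi_block_carrier:
  assumes "i \<in> {1..n}" "j \<in> {1..n}"
  shows "Psi_block n k w i j \<in> carrier_mat K (K div k j)"
  using assms E_mat_carrier Lambda_mat_carrier unfolding Psi_block_def
  by (auto intro!: mult_carrier_mat)

lemma b_block_carrier: "b_block n k c w i \<in> carrier_mat K 1"
  using Lambda_mat_carrier payoff_vec_carrier unfolding b_block_def
  by (auto intro!: mult_carrier_mat minus_carrier_mat)

lemma b_block_index:
  assumes "i \<in> {1..n}" "s \<in> profiles k {1..n}"
  shows "b_block n k c w i $$ (pos s, 0) = weight 1 s * c i s - weight i s * c 1 s"
proof -
  have one: "1 \<in> {1..n}" using two_players by auto
  have T: "transpose_mat (payoff_vec n k c j) \<in> carrier_mat K 1" for j
    using payoff_vec_carrier by simp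
  have Ti: "transpose_mat (payoff_vec n k c j) $$ (pos s, 0) = c j s" for j
    using payoff_vec_carrier[of j] pos_less[OF assms(2)] payoff_vec_index[OF assms(2)] by simp
  have "\<Lambda> j * transpose_mat (payoff_vec n k c l) \<in> carrier_mat K 1" for j l
    using Lambda_mat_carrier T by (rule mult_carrier_mat)
  then show ?thesis
    using Lambda_mult_index[OF assms T, of 0 1] Lambda_mult_index[OF one assms(2) T, of 0 i]
      pos_less[OF assms(2)] Ti
    unfolding b_block_def
    by (simp add: carrier_matD[OF Lambda_mat_carrier] carrier_matD[OF payoff_vec_carrier]
        del: index_mult_mat(1))
qed

text \<open>After reassociating, E_j first copies the entry of the block at s_-j, and the diagonal
  matrix then scales it by a weight.\<close>

lemma Psi_block_mult_index:
  assumes "i \<in> {2..n}" "j \<in> {1..n}" "s \<in> profiles k {1..n}" "X \<in> carrier_mat (K div k j) 1"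
  shows "(Psi_block n k w i j * X) $$ (pos s, 0) =
    (if j = 1 then - weight i s * X $$ (opp_pos 1 s, 0)
     else if j = i then weight 1 s * X $$ (opp_pos i s, 0) else 0)"
proof -
  have one: "1 \<in> {1..n}" using two_players by auto
  have i: "i \<in> {1..n}" using assms(1) by auto
  have prod: "(\<Lambda> l * E_mat n k j * X) $$ (pos s, 0) = weight l s * X $$ (opp_pos j s, 0)"
    if "l \<in> {1..n}" for l
  proof -
    have "\<Lambda> l * E_mat n k j * X = \<Lambda> l * (E_mat n k j * X)"
      using Lambda_mat_carrier E_mat_carrier[OF assms(2)] assms(4) by (rule assoc_mult_mat)
    then show ?thesis
      using Lambda_mult_index[OF that assms(3) mult_carrier_mat[OF E_mat_carrier[OF assms(2)] assms(4)], of 0]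
        E_mat_mult_index[OF assms(2,3,4)] by simp
  qed
  have c: "\<Lambda> l * E_mat n k j \<in> carrier_mat K (K div k j)" for l
    using Lambda_mat_carrier E_mat_carrier[OF assms(2)] by (rule mult_carrier_mat)
  have "(- (\<Lambda> i * E_mat n k j) * X) $$ (pos s, 0) = - ((\<Lambda> i * E_mat n k j * X) $$ (pos s, 0))"
    using c[of i] assms(4) pos_less[OF assms(3)] carrier_matD[OF Lambda_mat_carrier]
      carrier_matD[OF E_mat_carrier[OF assms(2)]]
    by (subst uminus_mult_left_mat) (simp_all del: index_mult_mat(1))
  then show ?thesis
    using prod[OF i] prod[OF one] pos_less[OF assms(3)] assms(4) unfolding Psi_block_def by auto
qed

text \<open>Block row i is compared with b^w_i entry by entry, and the rows are enumerated by
  profiles through \<open>pos_surj\<close>.\<close>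

lemma solves_system_iff:
  "solves_system n k c w \<xi> \<longleftrightarrow>
    (\<forall>i\<in>{1..n}. \<xi> i \<in> carrier_mat (K div k i) 1) \<and>
    (\<forall>i\<in>{2..n}. \<forall>s\<in>profiles k {1..n}.
      weight 1 s * \<xi> i $$ (opp_pos i s, 0) - weight i s * \<xi> 1 $$ (opp_pos 1 s, 0) =
      weight 1 s * c i s - weight i s * c 1 s)"
proof (cases "\<forall>i\<in>{1..n}. \<xi> i \<in> carrier_mat (K div k i) 1")
  case True
  let ?js = "[1..<Suc n]" and ?is = "[2..<Suc n]"
  let ?m = "\<Sum>j\<leftarrow>?js. K div k j"
  let ?row = "\<lambda>i. hstack K (map (Psi_block n k w i) ?js)"
  let ?lhs = "\<lambda>i. mat K 1 (\<lambda>(r, q). \<Sum>j\<leftarrow>?js. (Psi_block n k w i j * \<xi> j) $$ (r, q))"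
  have row: "?row i \<in> carrier_mat K ?m" if "i \<in> {2..n}" for i
    using that by (intro hstack_carrier Psi_block_carrier) auto
  have row_mult: "?row i * vstack 1 (map \<xi> ?js) = ?lhs i" if "i \<in> {2..n}" for i
    using that True by (intro hstack_mult_vstack[of _ _ _ "\<lambda>j. K div k j"] Psi_block_carrier) auto
  have X: "vstack 1 (map \<xi> ?js) \<in> carrier_mat ?m 1"
    using True by (intro vstack_carrier) auto
  have m: "(\<Sum>j=1..n. K div k j) = ?m"
    unfolding interv_sum_list_conv_sum_set_nat by (rule sum.cong) auto
  have "Psi_mat n k w * vstack 1 (map \<xi> ?js) = vstack 1 (map (\<lambda>i. ?row i * vstack 1 (map \<xi> ?js)) ?is)"
    unfolding Psi_mat_def m using row X by (intro vstack_mult[where d = "\<lambda>_. K"]) auto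
  also have "map (\<lambda>i. ?row i * vstack 1 (map \<xi> ?js)) ?is = map ?lhs ?is"
    using row_mult by (intro map_cong) auto
  finally have Psi_mult: "Psi_mat n k w * vstack 1 (map \<xi> ?js) = vstack 1 (map ?lhs ?is)" .
  have "solves_system n k c w \<xi> \<longleftrightarrow>
      vstack 1 (map ?lhs ?is) = vstack 1 (map (b_block n k c w) ?is)"
    unfolding solves_system_def b_vec_def Psi_mult using True by blast
  also have "\<dots> \<longleftrightarrow> (\<forall>i\<in>{2..n}. ?lhs i = b_block n k c w i)"
    using b_block_carrier by (subst vstack_eq_iff[where d = "\<lambda>_. K"]) (auto simp del: upt_Suc)
  also have "\<dots> \<longleftrightarrow> (\<forall>i\<in>{2..n}. \<forall>s\<in>profiles k {1..n}.
      ?lhs i $$ (pos s, 0) = b_block n k c w i $$ (pos s, 0))"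
  proof (intro ball_cong refl)
    fix i
    show "?lhs i = b_block n k c w i \<longleftrightarrow> (\<forall>s\<in>profiles k {1..n}.
      ?lhs i $$ (pos s, 0) = b_block n k c w i $$ (pos s, 0))"
    proof
      assume eq: "\<forall>s\<in>profiles k {1..n}. ?lhs i $$ (pos s, 0) = b_block n k c w i $$ (pos s, 0)"
      show "?lhs i = b_block n k c w i"
      proof (rule eq_matI)
        fix r q assume "r < dim_row (b_block n k c w i)" "q < dim_col (b_block n k c w i)"
        then have "r < K" and q: "q = 0"
          using b_block_carrier[of i] by auto
        from \<open>r < K\<close> obtain s where "s \<in> profiles k {1..n}" "pos s = r"
          by (rule pos_surj)
        with eq q show "?lhs i $$ (r, q) = b_block n k c w i $$ (r, q)"
          by blast
      qed (use b_block_carrier[of i] in auto)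
    qed simp
  qed
  also have "\<dots> \<longleftrightarrow> (\<forall>i\<in>{2..n}. \<forall>s\<in>profiles k {1..n}.
      weight 1 s * \<xi> i $$ (opp_pos i s, 0) - weight i s * \<xi> 1 $$ (opp_pos 1 s, 0) =
      weight 1 s * c i s - weight i s * c 1 s)"
  proof (intro ball_cong refl)
    fix i s assume i: "i \<in> {2..n}" and s: "s \<in> profiles k {1..n}"
    let ?g = "\<lambda>j. if j = 1 then - weight i s * \<xi> 1 $$ (opp_pos 1 s, 0)
      else if j = i then weight 1 s * \<xi> i $$ (opp_pos i s, 0) else 0"
    have "?lhs i $$ (pos s, 0) = (\<Sum>j\<leftarrow>?js. (Psi_block n k w i j * \<xi> j) $$ (pos s, 0))"
      using pos_less[OF s] by simp
    also have "\<dots> = (\<Sum>j\<in>{1..n}. (Psi_block n k w i j * \<xi> j) $$ (pos s, 0))"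
      unfolding interv_sum_list_conv_sum_set_nat by (rule sum.cong) auto
    also have "\<dots> = (\<Sum>j\<in>{1..n}. ?g j)"
    proof (rule sum.cong)
      fix j assume j: "j \<in> {1..n}"
      then show "(Psi_block n k w i j * \<xi> j) $$ (pos s, 0) = ?g j"
        using Psi_block_mult_index[OF i j s, of "\<xi> j"] True by auto
    qed simp
    \<comment> \<open>In block row i only columns 1 and i can contribute; they are distinct because
      i is at least 2.\<close>
    also have "\<dots> = (\<Sum>j\<in>{1, i}. ?g j)"
      using i by (intro sum.mono_neutral_right) auto
    also have "\<dots> = weight 1 s * \<xi> i $$ (opp_pos i s, 0) - weight i s * \<xi> 1 $$ (opp_pos 1 s, 0)"
      using i by simp
    finally show "?lhs i $$ (pos s, 0) = b_block n k c w i $$ (pos s, 0) \<longleftrightarrow>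
      weight 1 s * \<xi> i $$ (opp_pos i s, 0) - weight i s * \<xi> 1 $$ (opp_pos 1 s, 0) =
      weight 1 s * c i s - weight i s * c 1 s"
      using b_block_index[of i s] i s by simp
  qed
  finally show ?thesis
    using True by blast
next
  \<comment> \<open>Both sides demand the correct block dimensions, so both are false.\<close>
  case False
  then show ?thesis
    unfolding solves_system_def by blast
qed

section \<open>From a potential to a solution and back\<close>

lemma solution_of_potential:
  assumes P: "coset_weighted_potential n k c w P"
  shows "solves_system n k c w
    (\<lambda>i. transpose_mat (structure_vec k (opponents n i) (\<lambda>s. c i (s(i := 1)) - w i s * P (s(i := 1)))))"
    (is "solves_system n k c w ?\<xi>")
  unfolding solves_system_iff
proof (intro conjI ballI)
  show "?\<xi> i \<in> carrier_mat (K div k i) 1" if "i \<in> {1..n}" for i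
    using opp_structure_vec_carrier[OF that] by simp
next
  fix i s assume i: "i \<in> {2..n}" and s: "s \<in> profiles k {1..n}"
  then have i': "i \<in> {1..n}" and one: "1 \<in> {1..n}"
    by auto
  \<comment> \<open>A function on S_-j cannot use s_j, so the witness evaluates at own strategy 1.
    The potential identity shows that this choice does not affect the value.\<close>
  have xi: "?\<xi> j $$ (opp_pos j s, 0) = c j s - weight j s * P s" if j: "j \<in> {1..n}" for j
  proof -
    have "?\<xi> j $$ (opp_pos j s, 0) =
        structure_vec k (opponents n j) (\<lambda>s. c j (s(j := 1)) - w j s * P (s(j := 1))) $$ (0, opp_pos j s)"
      using opp_pos_less[OF j s] by (simp add: carrier_matD[OF opp_structure_vec_carrier[OF j]])
    also have "\<dots> = c j ((opp j s)(j := 1)) - weight j s * P ((opp j s)(j := 1))"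
      unfolding opp_structure_vec_index[OF s] weight_def by (rule refl)
    finally have "?\<xi> j $$ (opp_pos j s, 0) =
        c j ((opp j s)(j := 1)) - weight j s * P ((opp j s)(j := 1))" .
    moreover have "(opp j s)(j := s j) = s"
      using s j unfolding profiles_def by (auto simp: PiE_iff extensional_def fun_eq_iff)
    \<comment> \<open>The potential identity for the strategies \<open>s j\<close> and 1 of player
      j; strategy 1 exists because \<open>k j\<close> is positive.\<close>
    then have "c j s - c j ((opp j s)(j := 1)) = weight j s * (P s - P ((opp j s)(j := 1)))"
      using P[unfolded coset_weighted_potential_def, rule_format, OF j profile_range[OF s j] _
          opp_in_opp_profiles[OF s], of 1] strategies_pos[OF j]
      by (simp add: weight_def)
    ultimately show ?thesis by (simp add: algebra_simps)
  qed
  \<comment> \<open>Both terms with \<open>P s\<close> carry the coefficient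
    \<open>weight 1 s * weight i s\<close> and cancel.\<close>
  show "weight 1 s * ?\<xi> i $$ (opp_pos i s, 0) - weight i s * ?\<xi> 1 $$ (opp_pos 1 s, 0) =
      weight 1 s * c i s - weight i s * c 1 s"
    unfolding xi[OF i'] xi[OF one] by (simp add: algebra_simps)
qed

text \<open>\<open>P\<close> is prescribed on profiles only, so that the function computed from V^P
  can be inserted for it.\<close>

lemma potential_of_solution:
  assumes sol: "solves_system n k c w \<xi>"
    and P: "\<And>s. s \<in> profiles k {1..n} \<Longrightarrow> P s = (c 1 s - \<xi> 1 $$ (opp_pos 1 s, 0)) / weight 1 s"
  shows "coset_weighted_potential n k c w P"
  unfolding coset_weighted_potential_def
proof (intro ballI)
  fix i x y s assume i: "i \<in> {1..n}" and x: "x \<in> {1..k i}" and y: "y \<in> {1..k i}"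
    and s: "s \<in> opp_profiles n k i"
  \<comment> \<open>For i = 1 this is the formula for \<open>P\<close>. For other players it is
    equation i of the system after cancelling the positive factor \<open>weight 1 t\<close>.\<close>
  have key: "c i t - \<xi> i $$ (opp_pos i t, 0) = weight i t * P t" if t: "t \<in> profiles k {1..n}" for t
  proof -
    have pos: "weight 1 t > 0"
      using weight_profile_pos[OF _ t] two_players by simp
    then have wP: "weight 1 t * P t = c 1 t - \<xi> 1 $$ (opp_pos 1 t, 0)"
      by (simp add: P[OF t])
    show ?thesis
    proof (cases "i = 1")
      case True
      show ?thesis
        unfolding True wP by (rule refl)
    next
      case False
      then have "weight 1 t * (c i t - \<xi> i $$ (opp_pos i t, 0)) =
          weight i t * (c 1 t - \<xi> 1 $$ (opp_pos 1 t, 0))"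
        using sol[unfolded solves_system_iff] i t by (auto simp: algebra_simps)
      also have "\<dots> = weight 1 t * (weight i t * P t)"
        unfolding wP[symmetric] by (rule mult.left_commute)
      finally show ?thesis using pos by simp
    qed
  qed
  \<comment> \<open>Both deviations share s_-i, hence also the weight and the entry of xi_i, which
    drops out of the difference.\<close>
  have "weight i (s(i := z)) = w i s" for z
    by (simp only: weight_def opp_fun_upd[OF s])
  then show "c i (s(i := x)) - c i (s(i := y)) = w i s * (P (s(i := x)) - P (s(i := y)))"
    using key[OF fun_upd_in_profiles[OF i s x]] key[OF fun_upd_in_profiles[OF i s y]]
    by (simp add: opp_pos_fun_upd algebra_simps)
qed

text \<open>The joint strategy selects the entry at \<open>pos s\<close>; there E_1^T supplies xi_1
  at s_-1 and the inverse of Lambda_1 divides by the weight. The result is the formula expected by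
  \<open>potential_of_solution\<close>.\<close>

lemma potential_vec_index:
  assumes \<xi>: "\<xi> \<in> carrier_mat (K div k 1) 1" and s: "s \<in> profiles k {1..n}"
  shows "((payoff_vec n k c 1 - transpose_mat \<xi> * transpose_mat (E_mat n k 1))
      * the (mat_inverse (\<Lambda> 1)) * joint_strategy k (players n) s) $$ (0, 0) =
    (c 1 s - \<xi> $$ (opp_pos 1 s, 0)) / weight 1 s"
proof -
  have one: "1 \<in> {1..n}" using two_players by auto
  let ?U = "transpose_mat \<xi> * transpose_mat (E_mat n k 1)"
  have U: "?U \<in> carrier_mat 1 K"
    using \<xi> E_mat_carrier[OF one] by (intro mult_carrier_mat) auto
  have Ui: "?U $$ (0, pos s) = \<xi> $$ (opp_pos 1 s, 0)"
    using mult_transpose_E_mat_index[OF one s, of "transpose_mat \<xi>"] \<xi> opp_pos_less[OF one s] by simp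
  have V: "payoff_vec n k c 1 - ?U \<in> carrier_mat 1 K"
    using U by (rule minus_carrier_mat)
  have "(payoff_vec n k c 1 - ?U) $$ (0, pos s) = c 1 s - \<xi> $$ (opp_pos 1 s, 0)"
    using U pos_less[OF s] payoff_vec_index[OF s] Ui by (subst index_minus_mat) auto
  then show ?thesis
    using mult_inverse_Lambda_index[OF one s V] profile_range[OF s]
    by (subst row_times_joint_strategy) (auto simp: prod_players)
qed

end

theorem theorem7:
  fixes n :: nat and k :: "nat \<Rightarrow> nat"
    and c w :: "nat \<Rightarrow> (nat \<Rightarrow> nat) \<Rightarrow> real"
  assumes "n \<ge> 2"
    and "\<And>i. i \<in> {1..n} \<Longrightarrow> k i \<ge> 2"
    and "\<And>i s. i \<in> {1..n} \<Longrightarrow> s \<in> opp_profiles n k i \<Longrightarrow> w i s > 0"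
  shows "(coset_weighted_potential_game n k c w \<longleftrightarrow> (\<exists>\<xi>. solves_system n k c w \<xi>)) \<and>
    (\<forall>\<xi>. solves_system n k c w \<xi> \<longrightarrow>
      (let V1d = transpose_mat (\<xi> 1);
           VP = (payoff_vec n k c 1 - V1d * transpose_mat (E_mat n k 1))
                  * the (mat_inverse (Lambda_mat n k w 1))
       in coset_weighted_potential n k c w
            (\<lambda>s. (VP * joint_strategy k (players n) s) $$ (0, 0))))"
proof -
  interpret coset_weighted_game n k c w
    using assms by unfold_locales (auto simp: Suc_le_eq intro: less_le_trans[of 0 2])
  \<comment> \<open>Besides the explicit formula, this yields the implication from solvability to
    the existence of a potential.\<close>
  have pot: "coset_weighted_potential n k c w
      (\<lambda>s. ((payoff_vec n k c 1 - transpose_mat (\<xi> 1) * transpose_mat (E_mat n k 1))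
        * the (mat_inverse (Lambda_mat n k w 1)) * joint_strategy k (players n) s) $$ (0, 0))"
    if sol: "solves_system n k c w \<xi>" for \<xi>
  proof -
    have "\<xi> 1 \<in> carrier_mat (num_profiles n k div k 1) 1"
      using sol two_players unfolding solves_system_def by auto
    from sol potential_vec_index[OF this] show ?thesis
      by (rule potential_of_solution)
  qed
  then show ?thesis
    unfolding coset_weighted_potential_game_def Let_def using solution_of_potential by blast
qed

end
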